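(* Consider a commutative diagram of $\preceq$-morphisms of systemic modules over a semiring system $\mathcal A=(\mathcal A,\mathcal T_{\mathcal A},(-),\preceq)$ with rows $\mathcal M'\xrightarrow{q}\mathcal N'\xrightarrow{p}\mathcal L'$ and $\mathcal M\xrightarrow{l}\mathcal N\xrightarrow{r}\mathcal L$ and vertical maps $f:\mathcal M'\to\mathcal M$, $g:\mathcal N'\to\mathcal N$, $h:\mathcal L'\to\mathcal L$ (so $gq=lf$ and $hp=rg$), where $p$ is a $\succeq$-onto homomorphism, $g$ is a homomorphism, and $l$ is a $\preceq$-monic homomorphism. Suppose the top row is $\preceq$-exact (at $\mathcal N'$) and the bottom row is $\succeq$-exact (at $\mathcal N$). Then there is a natural well-defined $\mathcal T_{\mathcal A}$-equivariant map $$d:\ker_{\mathbf{Mod},\mathcal L'}h\to(\operatorname{coker}f)_{\mathrm{sys}},$$ given as follows: for $x_0\in\ker_{\mathbf{Mod},\mathcal L'}h$ choose $v_0\in\mathcal N'$ with $p(v_0)\succeq x_0$ and $u_0\in\mathcal M$ with $l(u_0)\succeq g(v_0)$, and let $d(x_0)$ be the class $[u_0]_f$. If moreover the $f$-minimality condition holds, then there is a natural $\preceq$-morphism $d:\ker_{\mathbf{Mod},\mathcal L'}h\to\mathcal M$, given by taking $d(x_0)$ to be the $f$-minimal such $u_0$, i.e. $d(x_0)=(u_0)_f$.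
   Context: A $\mathcal T$-module ($\mathcal T$ a multiplicative monoid) is a commutative additive monoid $(\mathcal A,+,0)$ with an action $\mathcal T\times\mathcal A\to\mathcal A$ such that $(a_1a_2)b=a_1(a_2b)$, $a0=0$, $a\sum_j b_j=\sum_j ab_j$. A negation map on it is an additive isomorphism $(-):\mathcal A\to\mathcal A$ of order $\le 2$, with a map $(-)$ of order $\le2$ on $\mathcal T$, such that $((-)a)b=(-)(ab)=a((-)b)$. Write $b(-)b'=b+((-)b')$, $b^\circ=b(-)b$, $\mathcal A^\circ=\{b^\circ\}$. A triple $(\mathcal A,\mathcal T,(-))$ is a $\mathcal T$-module $\mathcal A\supseteq\mathcal T$ with negation map, such that $\mathcal T\cap\mathcal A^\circ=\emptyset$ and $\mathcal T\cup\{0\}$ generates $(\mathcal A,+)$. A surpassing relation $\preceq$ is a preorder such that: $0\preceq c^\circ$ for all $c$; $b_1\preceq b_2\Rightarrow(-)b_1\preceq(-)b_2$; $b_1\preceq b_2,\ b_1'\preceq b_2'\Rightarrow b_1+b_1'\preceq b_2+b_2'$; $b_1\preceq b_2\Rightarrow ab_1\preceq ab_2$ for $a\in\mathcal T$; $a\preceq b$ with $a,b$ tangible (in $\mathcal T$) implies $a=b$. A system $(\mathcal A,\mathcal T,(-),\preceq)$ is a triple with a surpassing relation which is uniquely negated: for $a\in\mathcal T$, $(-)a$ is the unique $b\in\mathcal T$ with $0\preceq a+b$. It is a semiring system if $\mathcal A$ is a semiring. Write $b\succeq b'$ for $b'\preceq b$. A systemic module $(\mathcal M,\mathcal T_{\mathcal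 M},(-),\preceq)$ over a semiring system $\mathcal A$ is an $\mathcal A$-module $\mathcal M$ with a negation map satisfying $((-)a)m=(-)(am)=a((-)m)$, a spanning subset $\mathcal T_{\mathcal M}$ (tangible elements) with $\mathcal T\mathcal T_{\mathcal M}\subseteq\mathcal T_{\mathcal M}$, and a surpassing relation $\preceq$ (same axioms, with $\mathcal T_{\mathcal M}$ as tangible elements) with $am\preceq a'm'$ whenever $a\preceq a'$, $m\preceq m'$, and uniquely negated. A $\preceq$-morphism $f:\mathcal M\to\mathcal M'$ satisfies $f(0)=0$, $f(ab)=af(b)$ for $a\in\mathcal T$, $f((-)b)=(-)f(b)$, $b\preceq b'\Rightarrow f(b)\preceq f(b')$, and $f(b+b')\preceq f(b)+f(b')$; it is a homomorphism if equality holds in the last condition. $\ker_{\mathbf{Mod},\mathcal M}f=\{b\in\mathcal M:f(b)\succeq0\}$; $f(\mathcal M)_\preceq=\{b'\in\mathcal M':f(b)\preceq b'\text{ for some }b\in\mathcal M\}$; $f(\mathcal M)_\succeq=\{b'\in\mathcal M':f(b)\succeq b'\text{ for some }b\in\mathcal M\}$. $f$ is $\succeq$-onto if $f(\mathcal M)_\succeq=\mathcal M'$; $f$ is $\preceq$-monic if $f(b_0)\preceq f(b_1)$ implies $b_0\preceq b_1$. A sequence $\mathcal K\xrightarrow{k}\mathcal M\xrightarrow{f}\mathcal N$ is $\preceq$-exact at $\mathcal M$ if $k(\mathcal K)_\preceq=\ker_{\mathbf{Mod},\mathcal M}f$, and $\succeq$-exact at $\mathcal M$ if $k(\mathcal K)_\succeq=\ker_{\mathbf{Mod},\mathcal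 M}f$. For $f:\mathcal M'\to\mathcal M$ and $b\in\mathcal M$, $[b]_f=\{b'\in\mathcal M:f(c)\preceq b'(-)b\text{ for some }c\in\mathcal M'\}$, and the systemic cokernel is $(\operatorname{coker}f)_{\mathrm{sys}}=\{[b]_f:b\in\mathcal M\}$, with $\mathcal T_{\mathcal A}$ acting by $a[b]_f=[ab]_f$. The $f$-minimality condition: each $[b]_f$ has a unique minimal element (with respect to $\preceq$), denoted $b_f$.
   Formalization: As stated, [u₀]_f can depend on the choice and d(ax)=a·d(x) can fail; these are claimed when the classes [b]_f partition M, resp. when (ab)_f=a·b_f (shown if T_A is a group; in general d(ax)=(a·d(x))_f). "Unique minimal" is read as unique smallest. *)

theory Defs
  imports "HOL-Library.FuncSet" "HOL-Library.Disjoint_Sets"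
begin

text \<open>
  Carriers are whole types: the addition of a system or of a module is the one of the class
  \<^class>\<open>comm_monoid_add\<close>, the multiplication of a semiring system the one of \<^class>\<open>semiring_1\<close>.
  The remaining data are kept in records.
\<close>

record 'm system =
  tang :: "'m set"
  neg :: "'m \<Rightarrow> 'm"  (\<open>\<ominus>\<index> _\<close> [81] 80)
  surp :: "'m \<Rightarrow> 'm \<Rightarrow> bool"  (infix \<open>\<preceq>\<index>\<close> 50)

record ('a, 'm) smodule = "'m system" +
  smult :: "'a \<Rightarrow> 'm \<Rightarrow> 'm"  (infixr \<open>\<odot>\<index>\<close> 75)

inductive_set add_span :: "'m::comm_monoid_add set \<Rightarrow> 'm set" for X where
  zero: "0 \<in> add_span X"
| incl: "x \<in> X \<Longrightarrow> x \<in> add_span X"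
| add: "x \<in> add_span X \<Longrightarrow> y \<in> add_span X \<Longrightarrow> x + y \<in> add_span X"

text \<open>
  The axioms on negation map and surpassing relation that do not mention scalars. The last axiom
  is unique negation; it contains the closure of the tangible elements under negation.
\<close>

locale surpassing =
  fixes S :: "('m::comm_monoid_add, 'z) system_scheme" (structure)
  assumes neg_add: "\<ominus> (b + b') = \<ominus> b + \<ominus> b'"
    and neg_neg: "\<ominus> (\<ominus> b) = b"
    and surp_refl: "b \<preceq> b"
    and surp_trans: "b \<preceq> b' \<Longrightarrow> b' \<preceq> b'' \<Longrightarrow> b \<preceq> b''"
    and surp_quasi_zero: "0 \<preceq> c + \<ominus> c"
    and surp_neg: "b \<preceq> b' \<Longrightarrow> \<ominus> b \<preceq> \<ominus> b'"
    and surp_add: "b \<preceq> b' \<Longrightarrow> c \<preceq> c' \<Longrightarrow> b + c \<preceq> b' + c'"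
    and surp_tang: "a \<in> tang S \<Longrightarrow> b \<in> tang S \<Longrightarrow> a \<preceq> b \<Longrightarrow> a = b"
    and uniquely_negated: "a \<in> tang S \<Longrightarrow> b \<in> tang S \<and> 0 \<preceq> a + b \<longleftrightarrow> b = \<ominus> a"

locale semiring_system = surpassing A
  for A :: "('a::semiring_1, 'z) system_scheme" (structure) +
  assumes one_tang: "1 \<in> tang A"
    and mult_tang: "a \<in> tang A \<Longrightarrow> b \<in> tang A \<Longrightarrow> a * b \<in> tang A"
    and neg_mult_left: "a \<in> tang A \<Longrightarrow> (\<ominus> a) * b = \<ominus> (a * b)"
    and neg_mult_right: "a \<in> tang A \<Longrightarrow> a * (\<ominus> b) = \<ominus> (a * b)"
    and tang_not_quasi_zero: "tang A \<inter> range (\<lambda>b. b + \<ominus> b) = {}"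
    and tang_generates: "add_span (tang A) = UNIV"
    and surp_mult: "a \<in> tang A \<Longrightarrow> b \<preceq> b' \<Longrightarrow> a * b \<preceq> a * b'"

locale systemic_module = semiring_system A + surpassing M
  for A :: "'a::semiring_1 system" and M :: "('a, 'm::comm_monoid_add) smodule" (structure) +
  assumes smult_smult: "(a * a') \<odot> m = a \<odot> (a' \<odot> m)"
    and one_smult: "1 \<odot> m = m"
    and zero_smult: "0 \<odot> m = 0"
    and smult_zero: "a \<odot> 0 = 0"
    and smult_add: "a \<odot> (m + m') = a \<odot> m + a \<odot> m'"
    and add_smult: "(a + a') \<odot> m = a \<odot> m + a' \<odot> m"
    and neg_smult: "(\<ominus>\<^bsub>A\<^esub> a) \<odot> m = \<ominus> (a \<odot> m)"
    and smult_neg: "a \<odot> (\<ominus> m) = \<ominus> (a \<odot> m)"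
    and smult_tang: "a \<in> tang A \<Longrightarrow> m \<in> tang M \<Longrightarrow> a \<odot> m \<in> tang M"
    and tang_spans: "add_span {a \<odot> m |a m. m \<in> tang M} = UNIV"
    and surp_smult_tang: "a \<in> tang A \<Longrightarrow> m \<preceq> m' \<Longrightarrow> a \<odot> m \<preceq> a \<odot> m'"
    and surp_smult: "a \<preceq>\<^bsub>A\<^esub> a' \<Longrightarrow> m \<preceq> m' \<Longrightarrow> a \<odot> m \<preceq> a' \<odot> m'"

text \<open>
  Morphisms are defined on a subset of a module because the kernel of a
  \<open>\<preceq>\<close>-morphism need not be closed under addition. On all of the module, that is for \<open>K = UNIV\<close>,
  the premise \<open>b + b' \<in> K\<close> is void.
\<close>

definition surp_additive_on ::
  "'m set \<Rightarrow> ('a, 'm::comm_monoid_add) smodule \<Rightarrow> ('a, 'n::comm_monoid_add) smodule \<Rightarrow> ('m \<Rightarrow> 'n) \<Rightarrow> bool"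
where
  "surp_additive_on K M N f \<longleftrightarrow>
     f 0 = 0 \<and>
     (\<forall>b\<in>K. f (\<ominus>\<^bsub>M\<^esub> b) = \<ominus>\<^bsub>N\<^esub> f b) \<and>
     (\<forall>b\<in>K. \<forall>b'\<in>K. b \<preceq>\<^bsub>M\<^esub> b' \<longrightarrow> f b \<preceq>\<^bsub>N\<^esub> f b') \<and>
     (\<forall>b\<in>K. \<forall>b'\<in>K. b + b' \<in> K \<longrightarrow> f (b + b') \<preceq>\<^bsub>N\<^esub> f b + f b')"

definition surp_morphism_on ::
  "'m set \<Rightarrow> 'a system \<Rightarrow> ('a, 'm::comm_monoid_add) smodule \<Rightarrow> ('a, 'n::comm_monoid_add) smodule
    \<Rightarrow> ('m \<Rightarrow> 'n) \<Rightarrow> bool"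
where
  "surp_morphism_on K A M N f \<longleftrightarrow>
     surp_additive_on K M N f \<and> (\<forall>a\<in>tang A. \<forall>b\<in>K. f (a \<odot>\<^bsub>M\<^esub> b) = a \<odot>\<^bsub>N\<^esub> f b)"

abbreviation surp_morphism ::
  "'a system \<Rightarrow> ('a, 'm::comm_monoid_add) smodule \<Rightarrow> ('a, 'n::comm_monoid_add) smodule
    \<Rightarrow> ('m \<Rightarrow> 'n) \<Rightarrow> bool"
where
  "surp_morphism \<equiv> surp_morphism_on UNIV"

definition homomorphism ::
  "'a system \<Rightarrow> ('a, 'm::comm_monoid_add) smodule \<Rightarrow> ('a, 'n::comm_monoid_add) smodule
    \<Rightarrow> ('m \<Rightarrow> 'n) \<Rightarrow> bool"
where
  "homomorphism A M N f \<longleftrightarrow>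
     surp_morphism A M N f \<and> (\<forall>b b'. f (b + b') = f b + f b')"

definition ker_Mod :: "('a, 'n::comm_monoid_add) smodule \<Rightarrow> ('m \<Rightarrow> 'n) \<Rightarrow> 'm set" where
  "ker_Mod N f = {b. 0 \<preceq>\<^bsub>N\<^esub> f b}"

definition image_prec :: "('a, 'n) smodule \<Rightarrow> ('m \<Rightarrow> 'n) \<Rightarrow> 'n set" where
  "image_prec N f = {b'. \<exists>b. f b \<preceq>\<^bsub>N\<^esub> b'}"

definition image_succ :: "('a, 'n) smodule \<Rightarrow> ('m \<Rightarrow> 'n) \<Rightarrow> 'n set" where
  "image_succ N f = {b'. \<exists>b. b' \<preceq>\<^bsub>N\<^esub> f b}"

definition succ_onto :: "('a, 'n) smodule \<Rightarrow> ('m \<Rightarrow> 'n) \<Rightarrow> bool" where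
  "succ_onto N f \<longleftrightarrow> image_succ N f = UNIV"

definition prec_monic :: "('a, 'm) smodule \<Rightarrow> ('a, 'n) smodule \<Rightarrow> ('m \<Rightarrow> 'n) \<Rightarrow> bool" where
  "prec_monic M N f \<longleftrightarrow> (\<forall>b b'. f b \<preceq>\<^bsub>N\<^esub> f b' \<longrightarrow> b \<preceq>\<^bsub>M\<^esub> b')"

definition prec_exact ::
  "('a, 'm) smodule \<Rightarrow> ('a, 'n::comm_monoid_add) smodule \<Rightarrow> ('k \<Rightarrow> 'm) \<Rightarrow> ('m \<Rightarrow> 'n) \<Rightarrow> bool" where
  "prec_exact M N k f \<longleftrightarrow> image_prec M k = ker_Mod N f"

definition succ_exact ::
  "('a, 'm) smodule \<Rightarrow> ('a, 'n::comm_monoid_add) smodule \<Rightarrow> ('k \<Rightarrow> 'm) \<Rightarrow> ('m \<Rightarrow> 'n) \<Rightarrow> bool" where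
  "succ_exact M N k f \<longleftrightarrow> image_succ M k = ker_Mod N f"

text \<open>
  The class of \<open>b\<close> contains \<open>b\<close>, and \<open>b' \<in> sys_class M f b\<close> is a symmetric condition on
  \<open>b\<close> and \<open>b'\<close>, but without further hypotheses it is not transitive: classes may overlap.
\<close>

definition sys_class :: "('a, 'm::comm_monoid_add) smodule \<Rightarrow> ('k \<Rightarrow> 'm) \<Rightarrow> 'm \<Rightarrow> 'm set" where
  "sys_class M f b = {b'. \<exists>c. f c \<preceq>\<^bsub>M\<^esub> b' + \<ominus>\<^bsub>M\<^esub> b}"

definition coker_sys :: "('a, 'm::comm_monoid_add) smodule \<Rightarrow> ('k \<Rightarrow> 'm) \<Rightarrow> 'm set set" where
  "coker_sys M f = range (sys_class M f)"

text \<open>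
  The minimal element of a class is understood as its smallest element. As \<open>\<preceq>\<close> is only a preorder,
  uniqueness has to be required; the unique smallest element is then the only minimal one.
\<close>

definition is_minimal_rep :: "('a, 'm::comm_monoid_add) smodule \<Rightarrow> ('k \<Rightarrow> 'm) \<Rightarrow> 'm \<Rightarrow> 'm \<Rightarrow> bool"
where
  "is_minimal_rep M f b m \<longleftrightarrow>
     m \<in> sys_class M f b \<and> (\<forall>b'\<in>sys_class M f b. m \<preceq>\<^bsub>M\<^esub> b')"

definition minimality :: "('a, 'm::comm_monoid_add) smodule \<Rightarrow> ('k \<Rightarrow> 'm) \<Rightarrow> bool" where
  "minimality M f \<longleftrightarrow> (\<forall>b. \<exists>!m. is_minimal_rep M f b m)"

definition minimal_rep :: "('a, 'm::comm_monoid_add) smodule \<Rightarrow> ('k \<Rightarrow> 'm) \<Rightarrow> 'm \<Rightarrow> 'm" where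
  "minimal_rep M f b = (THE m. is_minimal_rep M f b m)"

definition minimal_reps_equivariant ::
  "'a system \<Rightarrow> ('a, 'm::comm_monoid_add) smodule \<Rightarrow> ('k \<Rightarrow> 'm) \<Rightarrow> bool"
where
  "minimal_reps_equivariant A M f \<longleftrightarrow>
     (\<forall>a\<in>tang A. \<forall>b. minimal_rep M f (a \<odot>\<^bsub>M\<^esub> b) = a \<odot>\<^bsub>M\<^esub> minimal_rep M f b)"

definition connecting_choice ::
  "('a, 'l') smodule \<Rightarrow> ('a, 'n) smodule \<Rightarrow> ('n' \<Rightarrow> 'l') \<Rightarrow> ('n' \<Rightarrow> 'n) \<Rightarrow> ('m \<Rightarrow> 'n)
    \<Rightarrow> 'l' \<Rightarrow> 'n' \<Rightarrow> 'm \<Rightarrow> bool"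
where
  "connecting_choice L' N p g l x\<^sub>0 v\<^sub>0 u\<^sub>0 \<longleftrightarrow> x\<^sub>0 \<preceq>\<^bsub>L'\<^esub> p v\<^sub>0 \<and> g v\<^sub>0 \<preceq>\<^bsub>N\<^esub> l u\<^sub>0"

end

theory Submission
  imports Defs
begin

text \<open>
  The connecting map is found by the usual diagram chase, with every equation replaced by a
  comparison. For \<open>x\<close> in the kernel of \<open>h\<close>, surjectivity of \<open>p\<close> yields \<open>v\<close> with \<open>x \<preceq> p v\<close>;
  then \<open>0 \<preceq> h x \<preceq> h (p v) = r (g v)\<close>, so exactness of the bottom row yields \<open>u\<close> with
  \<open>g v \<preceq> l u\<close>. For a second choice \<open>v', u'\<close>, subtracting \<open>x \<preceq> p v\<close> from \<open>x \<preceq> p v'\<close> gives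
  \<open>0 \<preceq> p (v' (-) v)\<close>, because \<open>0 \<preceq> x (-) x\<close>. Exactness of the top row gives
  \<open>q c \<preceq> v' (-) v\<close>; applying \<open>g\<close> yields \<open>l (f c) \<preceq> l (u' (-) u)\<close>, and \<open>l\<close> can be cancelled.
  Thus \<open>u'\<close> lies in the class of \<open>u\<close>.

  The remaining work concerns the classes themselves, for a single \<open>\<preceq>\<close>-morphism \<open>f\<close>. The
  relation \<open>b' \<in> [b]\<close> is reflexive, symmetric, compatible with sums, negation and tangible
  scalars, and upward closed in \<open>b\<close> and in \<open>b'\<close>, but need not be transitive. When every class has
  a smallest element \<open>b\<^sub>f\<close>, upward closure makes it transitive: if \<open>x \<in> [b]\<close>, then
  \<open>b\<^sub>f \<preceq> x\<close> gives \<open>b\<^sub>f \<in> [b\<^sub>f] \<subseteq> [x]\<close>, and since everything in \<open>[b]\<close> lies above \<open>b\<^sub>f\<close>, all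
  of \<open>[b]\<close> is contained in \<open>[x]\<close>; the converse inclusion follows by symmetry. Hence \<open>x \<mapsto> (u)\<^sub>f\<close> is independent of all choices.

  The \<open>\<preceq>\<close>-morphism axioms now come from the operations on classes. A choice for a
  larger \<open>x\<close> is also a choice for every smaller one, so the map is even constant along \<open>\<preceq>\<close>.
  The value at \<open>0\<close> is \<open>m = 0\<^sub>f\<close>, which is its own negative, and \<open>0 \<preceq> m (-) m = m + m \<preceq> m\<close>
  makes \<open>0\<close> itself smallest. For a tangible scalar \<open>a\<close> the element \<open>a b\<^sub>f\<close> lies in \<open>[a b]\<close>,
  whence \<open>(a b)\<^sub>f \<preceq> a b\<^sub>f\<close>; if tangible scalars are invertible, applying this to the inverse
  gives equality.
\<close>

section \<open>Negation and surpassing relation\<close>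

context surpassing
begin

lemma neg_zero: "\<ominus> 0 = 0"
proof -
  have "\<ominus> 0 = \<ominus> 0 + \<ominus> (\<ominus> 0)"
    by (simp add: neg_neg)
  also have "\<dots> = \<ominus> (0 + \<ominus> 0)"
    by (simp only: neg_add)
  also have "\<dots> = 0"
    by (simp add: neg_neg)
  finally show ?thesis .
qed

lemma surp_diff: "b \<preceq> b' \<Longrightarrow> c \<preceq> c' \<Longrightarrow> b + \<ominus> c \<preceq> b' + \<ominus> c'"
  by (intro surp_add surp_neg)

end

section \<open>Classes in the systemic cokernel\<close>

locale systemic_morphism = dom: systemic_module A M' + cod: systemic_module A M
  for A :: "'a::semiring_1 system"
    and M' :: "('a, 'k::comm_monoid_add) smodule"
    and M :: "('a, 'm::comm_monoid_add) smodule" +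
  fixes f :: "'k \<Rightarrow> 'm"
  assumes morphism: "surp_morphism A M' M f"
begin

lemma map_zero: "f 0 = 0"
  and map_neg: "f (\<ominus>\<^bsub>M'\<^esub> c) = \<ominus>\<^bsub>M\<^esub> f c"
  and map_mono: "c \<preceq>\<^bsub>M'\<^esub> c' \<Longrightarrow> f c \<preceq>\<^bsub>M\<^esub> f c'"
  and map_add: "f (c + c') \<preceq>\<^bsub>M\<^esub> f c + f c'"
  and map_smult: "a \<in> tang A \<Longrightarrow> f (a \<odot>\<^bsub>M'\<^esub> c) = a \<odot>\<^bsub>M\<^esub> f c"
  using morphism by (auto simp: surp_morphism_on_def surp_additive_on_def)

lemma mem_sys_class_iff: "b' \<in> sys_class M f b \<longleftrightarrow> (\<exists>c. f c \<preceq>\<^bsub>M\<^esub> b' + \<ominus>\<^bsub>M\<^esub> b)"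
  by (simp add: sys_class_def)

lemma sys_class_refl: "b \<in> sys_class M f b"
  unfolding mem_sys_class_iff using map_zero cod.surp_quasi_zero by metis

lemma sys_class_sym:
  assumes "b' \<in> sys_class M f b"
  shows "b \<in> sys_class M f b'"
proof -
  obtain c where "f c \<preceq>\<^bsub>M\<^esub> b' + \<ominus>\<^bsub>M\<^esub> b"
    using assms by (auto simp: mem_sys_class_iff)
  then have "f (\<ominus>\<^bsub>M'\<^esub> c) \<preceq>\<^bsub>M\<^esub> \<ominus>\<^bsub>M\<^esub> (b' + \<ominus>\<^bsub>M\<^esub> b)"
    by (simp add: map_neg cod.surp_neg)
  then show ?thesis
    by (auto simp: mem_sys_class_iff cod.neg_add cod.neg_neg add.commute)
qed

lemma sys_class_upward:
  assumes "b' \<in> sys_class M f b" and "b' \<preceq>\<^bsub>M\<^esub> b''"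
  shows "b'' \<in> sys_class M f b"
proof -
  obtain c where "f c \<preceq>\<^bsub>M\<^esub> b' + \<ominus>\<^bsub>M\<^esub> b"
    using assms(1) by (auto simp: mem_sys_class_iff)
  then have "f c \<preceq>\<^bsub>M\<^esub> b'' + \<ominus>\<^bsub>M\<^esub> b"
    using cod.surp_trans cod.surp_diff[OF assms(2) cod.surp_refl] by blast
  then show ?thesis
    by (auto simp: mem_sys_class_iff)
qed

lemma sys_class_mono: "b \<preceq>\<^bsub>M\<^esub> b' \<Longrightarrow> sys_class M f b \<subseteq> sys_class M f b'"
  using sys_class_sym sys_class_upward by blast

lemma sys_class_neg:
  assumes "b' \<in> sys_class M f b"
  shows "\<ominus>\<^bsub>M\<^esub> b' \<in> sys_class M f (\<ominus>\<^bsub>M\<^esub> b)"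
proof -
  obtain c where "f c \<preceq>\<^bsub>M\<^esub> b' + \<ominus>\<^bsub>M\<^esub> b"
    using assms by (auto simp: mem_sys_class_iff)
  then have "f (\<ominus>\<^bsub>M'\<^esub> c) \<preceq>\<^bsub>M\<^esub> \<ominus>\<^bsub>M\<^esub> b' + \<ominus>\<^bsub>M\<^esub> (\<ominus>\<^bsub>M\<^esub> b)"
    by (simp add: map_neg cod.surp_neg flip: cod.neg_add)
  then show ?thesis
    by (auto simp: mem_sys_class_iff)
qed

lemma sys_class_add:
  assumes "b\<^sub>1' \<in> sys_class M f b\<^sub>1" and "b\<^sub>2' \<in> sys_class M f b\<^sub>2"
  shows "b\<^sub>1' + b\<^sub>2' \<in> sys_class M f (b\<^sub>1 + b\<^sub>2)"
proof -
  obtain c\<^sub>1 c\<^sub>2 where "f c\<^sub>1 \<preceq>\<^bsub>M\<^esub> b\<^sub>1' + \<ominus>\<^bsub>M\<^esub> b\<^sub>1" and "f c\<^sub>2 \<preceq>\<^bsub>M\<^esub> b\<^sub>2' + \<ominus>\<^bsub>M\<^esub> b\<^sub>2"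
    using assms by (auto simp: mem_sys_class_iff)
  then have "f c\<^sub>1 + f c\<^sub>2 \<preceq>\<^bsub>M\<^esub> (b\<^sub>1' + \<ominus>\<^bsub>M\<^esub> b\<^sub>1) + (b\<^sub>2' + \<ominus>\<^bsub>M\<^esub> b\<^sub>2)"
    by (rule cod.surp_add)
  then have "f (c\<^sub>1 + c\<^sub>2) \<preceq>\<^bsub>M\<^esub> (b\<^sub>1' + b\<^sub>2') + \<ominus>\<^bsub>M\<^esub> (b\<^sub>1 + b\<^sub>2)"
    using cod.surp_trans[OF map_add] by (simp add: cod.neg_add ac_simps)
  then show ?thesis
    by (auto simp: mem_sys_class_iff)
qed

lemma sys_class_smult:
  assumes a: "a \<in> tang A" and b': "b' \<in> sys_class M f b"
  shows "a \<odot>\<^bsub>M\<^esub> b' \<in> sys_class M f (a \<odot>\<^bsub>M\<^esub> b)"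
proof -
  obtain c where "f c \<preceq>\<^bsub>M\<^esub> b' + \<ominus>\<^bsub>M\<^esub> b"
    using b' by (auto simp: mem_sys_class_iff)
  then have "f (a \<odot>\<^bsub>M'\<^esub> c) \<preceq>\<^bsub>M\<^esub> a \<odot>\<^bsub>M\<^esub> (b' + \<ominus>\<^bsub>M\<^esub> b)"
    by (simp add: a map_smult cod.surp_smult_tang)
  then show ?thesis
    by (auto simp: mem_sys_class_iff cod.smult_add cod.smult_neg)
qed

lemma sys_class_eq_if_partition:
  assumes "partition_on UNIV (coker_sys M f)" and "b' \<in> sys_class M f b"
  shows "sys_class M f b' = sys_class M f b"
proof (rule ccontr)
  assume "sys_class M f b' \<noteq> sys_class M f b"
  then have "sys_class M f b' \<inter> sys_class M f b = {}"
    using assms(1) unfolding partition_on_def disjoint_def coker_sys_def by blast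
  then show False
    using assms(2) sys_class_refl by blast
qed

end

section \<open>Smallest representatives\<close>

locale minimal_systemic_morphism = systemic_morphism +
  assumes minimality: "minimality M f"
begin

lemma is_minimal_rep_minimal_rep: "is_minimal_rep M f b (minimal_rep M f b)"
  unfolding minimal_rep_def using minimality unfolding minimality_def by (blast intro: theI')

lemma minimal_rep_in_class: "minimal_rep M f b \<in> sys_class M f b"
  and minimal_rep_least: "b' \<in> sys_class M f b \<Longrightarrow> minimal_rep M f b \<preceq>\<^bsub>M\<^esub> b'"
  using is_minimal_rep_minimal_rep by (auto simp: is_minimal_rep_def)

lemma minimal_rep_eqI:
  assumes "m \<in> sys_class M f b" and "\<And>b'. b' \<in> sys_class M f b \<Longrightarrow> m \<preceq>\<^bsub>M\<^esub> b'"
  shows "minimal_rep M f b = m"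
  using minimality is_minimal_rep_minimal_rep assms
  unfolding minimality_def is_minimal_rep_def by metis

text \<open>
  Transitivity enters here. If \<open>x \<in> [b]\<close>, then \<open>b\<^sub>f\<close> lies below \<open>x\<close>, so by monotonicity of
  classes in their base point it belongs to \<open>[x]\<close>, and upward closure takes the rest of \<open>[b]\<close>
  along; the argument is symmetric in \<open>b\<close> and \<open>x\<close>.
\<close>

lemma sys_class_eq:
  assumes "x \<in> sys_class M f b"
  shows "sys_class M f x = sys_class M f b"
proof -
  have sub: "sys_class M f y \<subseteq> sys_class M f z" if y: "y \<in> sys_class M f z" for y z
  proof
    fix w
    assume w: "w \<in> sys_class M f y"
    have z: "z \<in> sys_class M f y"
      using y by (rule sys_class_sym)
    have "minimal_rep M f y \<in> sys_class M f z"
      using sys_class_mono[OF minimal_rep_least[OF z]] sys_class_refl by blast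
    then show "w \<in> sys_class M f z"
      using minimal_rep_least[OF w] by (rule sys_class_upward)
  qed
  show ?thesis
    using assms sys_class_sym by (blast dest: sub)
qed

lemma minimal_rep_cong: "x \<in> sys_class M f b \<Longrightarrow> minimal_rep M f x = minimal_rep M f b"
  unfolding minimal_rep_def is_minimal_rep_def by (simp add: sys_class_eq)

lemma partition_coker_sys: "partition_on UNIV (coker_sys M f)"
proof (rule partition_onI)
  show "\<Union> (coker_sys M f) = UNIV"
    unfolding coker_sys_def using sys_class_refl by blast
  show "disjnt X Y" if "X \<in> coker_sys M f" "Y \<in> coker_sys M f" "X \<noteq> Y" for X Y
    using that sys_class_eq unfolding coker_sys_def disjnt_def by blast
  show "{} \<notin> coker_sys M f"
    using sys_class_refl unfolding coker_sys_def by blast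
qed

lemma minimal_rep_neg: "minimal_rep M f (\<ominus>\<^bsub>M\<^esub> b) = \<ominus>\<^bsub>M\<^esub> minimal_rep M f b"
proof (rule minimal_rep_eqI)
  show "\<ominus>\<^bsub>M\<^esub> minimal_rep M f b \<in> sys_class M f (\<ominus>\<^bsub>M\<^esub> b)"
    by (rule sys_class_neg[OF minimal_rep_in_class])
  fix b'
  assume "b' \<in> sys_class M f (\<ominus>\<^bsub>M\<^esub> b)"
  then have "\<ominus>\<^bsub>M\<^esub> b' \<in> sys_class M f b"
    using sys_class_neg cod.neg_neg by metis
  then show "\<ominus>\<^bsub>M\<^esub> minimal_rep M f b \<preceq>\<^bsub>M\<^esub> b'"
    using cod.surp_neg[OF minimal_rep_least] cod.neg_neg by metis
qed

text \<open>
  A smallest element is below \<open>0\<close>, and a self-negative element \<open>m\<close> below \<open>0\<close> is also above \<open>0\<close>,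
  since \<open>0 \<preceq> m (-) m = m + m \<preceq> m\<close>. Because \<open>\<preceq>\<close> need not be antisymmetric, equality comes from
  the uniqueness of smallest elements.
\<close>

lemma minimal_rep_zero: "minimal_rep M f 0 = 0"
proof -
  let ?m = "minimal_rep M f 0"
  have self_neg: "\<ominus>\<^bsub>M\<^esub> ?m = ?m"
    using minimal_rep_neg[of 0] by (simp add: cod.neg_zero)
  have "?m + ?m \<preceq>\<^bsub>M\<^esub> ?m + 0"
    by (intro cod.surp_add cod.surp_refl minimal_rep_least sys_class_refl)
  then have "0 \<preceq>\<^bsub>M\<^esub> ?m"
    using cod.surp_trans cod.surp_quasi_zero[of ?m] by (simp add: self_neg)
  then show ?thesis
    using minimal_rep_least cod.surp_trans sys_class_refl by (blast intro: minimal_rep_eqI)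
qed

lemma minimal_rep_add:
  "minimal_rep M f (b + b') \<preceq>\<^bsub>M\<^esub> minimal_rep M f b + minimal_rep M f b'"
  by (intro minimal_rep_least sys_class_add minimal_rep_in_class)

lemma smult_minimal_rep_in_class:
  "a \<in> tang A \<Longrightarrow> a \<odot>\<^bsub>M\<^esub> minimal_rep M f b \<in> sys_class M f (a \<odot>\<^bsub>M\<^esub> b)"
  by (intro sys_class_smult minimal_rep_in_class)

text \<open>
  Multiplication by an invertible scalar \<open>a\<close> is an order isomorphism from \<open>[b]\<close> onto \<open>[a b]\<close>,
  so it preserves smallest elements.
\<close>

lemma minimal_reps_equivariant_if_invertible:
  assumes inv: "\<forall>a\<in>tang A. \<exists>a'\<in>tang A. a' * a = 1"
  shows "minimal_reps_equivariant A M f"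
  unfolding minimal_reps_equivariant_def
proof (intro ballI allI)
  fix a b
  assume a: "a \<in> tang A"
  obtain a' where a': "a' \<in> tang A" "a' * a = 1"
    using inv a by blast
  \<comment> \<open>a left inverse of \<open>a'\<close> must be \<open>a\<close>, so \<open>a'\<close> is a two-sided inverse\<close>
  obtain a'' where "a'' * a' = 1"
    using inv a' by blast
  then have aa': "a * a' = 1"
    using a' by (metis mult.assoc mult.left_neutral mult.right_neutral)
  show "minimal_rep M f (a \<odot>\<^bsub>M\<^esub> b) = a \<odot>\<^bsub>M\<^esub> minimal_rep M f b"
  proof (rule minimal_rep_eqI[OF smult_minimal_rep_in_class[OF a]])
    fix y
    assume "y \<in> sys_class M f (a \<odot>\<^bsub>M\<^esub> b)"
    then have "a' \<odot>\<^bsub>M\<^esub> y \<in> sys_class M f b"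
      using sys_class_smult[OF a'(1)] a'(2) cod.smult_smult cod.one_smult by metis
    then have "a \<odot>\<^bsub>M\<^esub> minimal_rep M f b \<preceq>\<^bsub>M\<^esub> a \<odot>\<^bsub>M\<^esub> (a' \<odot>\<^bsub>M\<^esub> y)"
      by (intro cod.surp_smult_tang[OF a] minimal_rep_least)
    then show "a \<odot>\<^bsub>M\<^esub> minimal_rep M f b \<preceq>\<^bsub>M\<^esub> y"
      by (simp add: aa' cod.one_smult flip: cod.smult_smult)
  qed
qed

end

section \<open>The diagram chase\<close>

locale snake_diagram =
  M': systemic_module A M' + N': systemic_module A N' + L': systemic_module A L' +
  M: systemic_module A M + N: systemic_module A N + L: systemic_module A L +
  f: systemic_morphism A M' M f + h: systemic_morphism A L' L h
  for A :: "'a::semiring_1 system"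
    and M' :: "('a, 'm'::comm_monoid_add) smodule"
    and N' :: "('a, 'n'::comm_monoid_add) smodule"
    and L' :: "('a, 'l'::comm_monoid_add) smodule"
    and M :: "('a, 'm::comm_monoid_add) smodule"
    and N :: "('a, 'n::comm_monoid_add) smodule"
    and L :: "('a, 'l::comm_monoid_add) smodule"
    and q :: "'m' \<Rightarrow> 'n'" and p :: "'n' \<Rightarrow> 'l'"
    and l :: "'m \<Rightarrow> 'n" and r :: "'n \<Rightarrow> 'l"
    and f :: "'m' \<Rightarrow> 'm" and g :: "'n' \<Rightarrow> 'n" and h :: "'l' \<Rightarrow> 'l" +
  assumes left_square: "g \<circ> q = l \<circ> f" and right_square: "h \<circ> p = r \<circ> g"
    and p_onto: "succ_onto L' p" and p_hom: "homomorphism A N' L' p"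
    and g_hom: "homomorphism A N' N g"
    and l_monic: "prec_monic M N l" and l_hom: "homomorphism A M N l"
    and top_exact: "prec_exact N' L' q p"
    and bottom_exact: "succ_exact N L l r"
begin

sublocale p: systemic_morphism A N' L' p
  using p_hom by unfold_locales (simp add: homomorphism_def)

sublocale g: systemic_morphism A N' N g
  using g_hom by unfold_locales (simp add: homomorphism_def)

sublocale l: systemic_morphism A M N l
  using l_hom by unfold_locales (simp add: homomorphism_def)

lemma hom_add: "p (v + v') = p v + p v'" "g (v + v') = g v + g v'" "l (u + u') = l u + l u'"
  using p_hom g_hom l_hom by (simp_all add: homomorphism_def)

abbreviation choice where "choice \<equiv> connecting_choice L' N p g l"

lemma zero_in_ker: "0 \<in> ker_Mod L h"
  by (simp add: ker_Mod_def h.map_zero L.surp_refl)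

lemma neg_in_ker: "x \<in> ker_Mod L h \<Longrightarrow> \<ominus>\<^bsub>L'\<^esub> x \<in> ker_Mod L h"
  using L.surp_neg[of 0 "h x"] by (simp add: ker_Mod_def h.map_neg L.neg_zero)

lemma smult_in_ker: "a \<in> tang A \<Longrightarrow> x \<in> ker_Mod L h \<Longrightarrow> a \<odot>\<^bsub>L'\<^esub> x \<in> ker_Mod L h"
  using L.surp_smult_tang[of a 0 "h x"] by (simp add: ker_Mod_def h.map_smult L.smult_zero)

lemma ex_lift: "\<exists>v. x \<preceq>\<^bsub>L'\<^esub> p v"
  using p_onto by (auto simp: succ_onto_def image_succ_def)

lemma ex_choice_of_lift:
  assumes "x \<in> ker_Mod L h" and "x \<preceq>\<^bsub>L'\<^esub> p v"
  shows "\<exists>u. g v \<preceq>\<^bsub>N\<^esub> l u"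
proof -
  have "0 \<preceq>\<^bsub>L\<^esub> h (p v)"
    using assms h.map_mono L.surp_trans unfolding ker_Mod_def by blast
  also have "h (p v) = r (g v)"
    using right_square by (simp add: fun_eq_iff)
  finally have "g v \<in> image_succ N l"
    using bottom_exact by (simp add: succ_exact_def ker_Mod_def)
  then show ?thesis
    by (simp add: image_succ_def)
qed

lemma ex_choice: "x \<in> ker_Mod L h \<Longrightarrow> \<exists>v u. choice x v u"
  unfolding connecting_choice_def using ex_lift ex_choice_of_lift by metis

text \<open>
  Well-definedness: the common lower bound \<open>x\<close> of \<open>p v\<close> and \<open>p v'\<close> replaces the equality
  \<open>p v = p v'\<close> of the classical chase, since the quasi-zero \<open>x (-) x\<close> lies above \<open>0\<close>.
\<close>

lemma choice_in_class:
  assumes "choice x v u" and "choice x v' u'"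
  shows "u' \<in> sys_class M f u"
proof -
  have "x + \<ominus>\<^bsub>L'\<^esub> x \<preceq>\<^bsub>L'\<^esub> p v' + \<ominus>\<^bsub>L'\<^esub> p v"
    using assms by (auto simp: connecting_choice_def intro: L'.surp_diff)
  then have "0 \<preceq>\<^bsub>L'\<^esub> p (v' + \<ominus>\<^bsub>N'\<^esub> v)"
    using L'.surp_trans[OF L'.surp_quasi_zero] by (simp add: hom_add p.map_neg)
  then have "v' + \<ominus>\<^bsub>N'\<^esub> v \<in> image_prec N' q"
    using top_exact by (simp add: prec_exact_def ker_Mod_def)
  then obtain c where "q c \<preceq>\<^bsub>N'\<^esub> v' + \<ominus>\<^bsub>N'\<^esub> v"
    by (auto simp: image_prec_def)
  then have "g (q c) \<preceq>\<^bsub>N\<^esub> g v' + \<ominus>\<^bsub>N\<^esub> g v"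
    using g.map_mono by (simp flip: hom_add g.map_neg)
  moreover have "g v' + \<ominus>\<^bsub>N\<^esub> g v \<preceq>\<^bsub>N\<^esub> l u' + \<ominus>\<^bsub>N\<^esub> l u"
    using assms by (auto simp: connecting_choice_def intro: N.surp_diff)
  moreover have "g (q c) = l (f c)"
    using left_square by (simp add: fun_eq_iff)
  ultimately have "l (f c) \<preceq>\<^bsub>N\<^esub> l (u' + \<ominus>\<^bsub>M\<^esub> u)"
    using N.surp_trans by (metis hom_add(3) l.map_neg)
  then have "f c \<preceq>\<^bsub>M\<^esub> u' + \<ominus>\<^bsub>M\<^esub> u"
    using l_monic by (simp add: prec_monic_def)
  then show ?thesis
    by (auto simp: sys_class_def)
qed

lemma choice_zero: "choice 0 0 0"
  by (simp add: connecting_choice_def p.map_zero g.map_zero l.map_zero L'.surp_refl N.surp_refl)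

lemma choice_neg: "choice x v u \<Longrightarrow> choice (\<ominus>\<^bsub>L'\<^esub> x) (\<ominus>\<^bsub>N'\<^esub> v) (\<ominus>\<^bsub>M\<^esub> u)"
  by (simp add: connecting_choice_def p.map_neg g.map_neg l.map_neg L'.surp_neg N.surp_neg)

lemma choice_add: "choice x v u \<Longrightarrow> choice x' v' u' \<Longrightarrow> choice (x + x') (v + v') (u + u')"
  by (simp add: connecting_choice_def hom_add L'.surp_add N.surp_add)

lemma choice_smult:
  "a \<in> tang A \<Longrightarrow> choice x v u \<Longrightarrow> choice (a \<odot>\<^bsub>L'\<^esub> x) (a \<odot>\<^bsub>N'\<^esub> v) (a \<odot>\<^bsub>M\<^esub> u)"
  by (simp add: connecting_choice_def p.map_smult g.map_smult l.map_smult
      L'.surp_smult_tang N.surp_smult_tang)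

text \<open>
  This turns monotonicity of the connecting maps into independence of the choice.
\<close>

lemma choice_antimono: "x \<preceq>\<^bsub>L'\<^esub> x' \<Longrightarrow> choice x' v u \<Longrightarrow> choice x v u"
  unfolding connecting_choice_def using L'.surp_trans by blast

definition chosen :: "'l' \<Rightarrow> 'm" where
  "chosen x = (SOME u. \<exists>v. choice x v u)"

lemma choice_chosen:
  assumes "x \<in> ker_Mod L h"
  shows "\<exists>v. choice x v (chosen x)"
proof -
  have "\<exists>u v. choice x v u"
    using ex_choice[OF assms] by blast
  then show ?thesis
    unfolding chosen_def by (rule someI_ex)
qed

section \<open>The connecting maps\<close>

text \<open>
  When classes overlap, two choices for the same \<open>x\<close> lie in each other's class, but the two classes
  may differ as sets, so one choice is singled out for every \<open>x\<close>.
\<close>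

definition class_map :: "'l' \<Rightarrow> 'm set" where
  "class_map = (\<lambda>x\<in>ker_Mod L h. sys_class M f (chosen x))"

lemma class_map_ker: "x \<in> ker_Mod L h \<Longrightarrow> class_map x = sys_class M f (chosen x)"
  by (simp add: class_map_def)

lemma class_map_in_coker: "class_map \<in> ker_Mod L h \<rightarrow>\<^sub>E coker_sys M f"
  by (auto simp: class_map_def coker_sys_def)

lemma class_map_choice:
  "x \<in> ker_Mod L h \<Longrightarrow> \<exists>v u. choice x v u \<and> class_map x = sys_class M f u"
  using choice_chosen class_map_ker by blast

lemma choice_in_class_map: "x \<in> ker_Mod L h \<Longrightarrow> choice x v u \<Longrightarrow> u \<in> class_map x"
  using class_map_choice choice_in_class by blast

lemma class_map_eq_if_partition:
  assumes "partition_on UNIV (coker_sys M f)" and "x \<in> ker_Mod L h" and "choice x v u"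
  shows "class_map x = sys_class M f u"
  using assms choice_in_class_map class_map_ker f.sys_class_eq_if_partition by metis

lemma class_map_equivariant_if_partition:
  assumes part: "partition_on UNIV (coker_sys M f)" and a: "a \<in> tang A"
    and x: "x \<in> ker_Mod L h" and b: "class_map x = sys_class M f b"
  shows "class_map (a \<odot>\<^bsub>L'\<^esub> x) = sys_class M f (a \<odot>\<^bsub>M\<^esub> b)"
proof -
  obtain v u where u: "choice x v u"
    using ex_choice[OF x] by blast
  then have "u \<in> sys_class M f b"
    using choice_in_class_map[OF x] b by blast
  then have "sys_class M f (a \<odot>\<^bsub>M\<^esub> u) = sys_class M f (a \<odot>\<^bsub>M\<^esub> b)"
    using f.sys_class_smult[OF a] f.sys_class_eq_if_partition[OF part] by blast
  then show ?thesis
    using class_map_eq_if_partition[OF part smult_in_ker[OF a x] choice_smult[OF a u]] by simp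
qed

end

locale minimal_snake_diagram = snake_diagram +
  assumes f_minimality: "minimality M f"
begin

sublocale f: minimal_systemic_morphism A M' M f
  by unfold_locales (rule f_minimality)

definition minimal_map where
  "minimal_map = (\<lambda>x\<in>ker_Mod L h. minimal_rep M f (chosen x))"

lemma minimal_map_choice:
  assumes "x \<in> ker_Mod L h" and "choice x v u"
  shows "minimal_map x = minimal_rep M f u"
  using assms choice_chosen choice_in_class f.minimal_rep_cong
  unfolding minimal_map_def by (metis restrict_apply')

lemma minimal_map_surp_additive: "surp_additive_on (ker_Mod L h) L' M minimal_map"
  unfolding surp_additive_on_def
proof (intro conjI ballI impI)
  show "minimal_map 0 = 0"
    using minimal_map_choice[OF zero_in_ker choice_zero] by (simp add: f.minimal_rep_zero)
next
  fix x
  assume x: "x \<in> ker_Mod L h"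
  then obtain v u where u: "choice x v u"
    using ex_choice by blast
  show "minimal_map (\<ominus>\<^bsub>L'\<^esub> x) = \<ominus>\<^bsub>M\<^esub> minimal_map x"
    using minimal_map_choice[OF neg_in_ker[OF x] choice_neg[OF u]] minimal_map_choice[OF x u]
    by (simp add: f.minimal_rep_neg)
next
  fix x x'
  assume x: "x \<in> ker_Mod L h" and x': "x' \<in> ker_Mod L h" and le: "x \<preceq>\<^bsub>L'\<^esub> x'"
  obtain v u where u: "choice x' v u"
    using ex_choice[OF x'] by blast
  have "minimal_map x = minimal_map x'"
    using minimal_map_choice[OF x choice_antimono[OF le u]] minimal_map_choice[OF x' u] by simp
  then show "minimal_map x \<preceq>\<^bsub>M\<^esub> minimal_map x'"
    by (simp add: M.surp_refl)
next
  fix x x'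
  assume x: "x \<in> ker_Mod L h" and x': "x' \<in> ker_Mod L h" and add: "x + x' \<in> ker_Mod L h"
  obtain v u v' u' where u: "choice x v u" and u': "choice x' v' u'"
    using ex_choice[OF x] ex_choice[OF x'] by blast
  show "minimal_map (x + x') \<preceq>\<^bsub>M\<^esub> minimal_map x + minimal_map x'"
    using minimal_map_choice[OF add choice_add[OF u u']]
      minimal_map_choice[OF x u] minimal_map_choice[OF x' u'] f.minimal_rep_add by simp
qed

lemma minimal_map_smult:
  assumes a: "a \<in> tang A" and x: "x \<in> ker_Mod L h"
  shows "minimal_map (a \<odot>\<^bsub>L'\<^esub> x) = minimal_rep M f (a \<odot>\<^bsub>M\<^esub> minimal_map x)"
    and "minimal_map (a \<odot>\<^bsub>L'\<^esub> x) \<preceq>\<^bsub>M\<^esub> a \<odot>\<^bsub>M\<^esub> minimal_map x"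
    and "minimal_reps_equivariant A M f \<Longrightarrow> minimal_map (a \<odot>\<^bsub>L'\<^esub> x) = a \<odot>\<^bsub>M\<^esub> minimal_map x"
proof -
  obtain v u where u: "choice x v u"
    using ex_choice[OF x] by blast
  note eqs = minimal_map_choice[OF smult_in_ker[OF a x] choice_smult[OF a u]]
    minimal_map_choice[OF x u]
  show "minimal_map (a \<odot>\<^bsub>L'\<^esub> x) = minimal_rep M f (a \<odot>\<^bsub>M\<^esub> minimal_map x)"
    using f.minimal_rep_cong[OF f.smult_minimal_rep_in_class[OF a]] by (simp add: eqs)
  show "minimal_map (a \<odot>\<^bsub>L'\<^esub> x) \<preceq>\<^bsub>M\<^esub> a \<odot>\<^bsub>M\<^esub> minimal_map x"
    using f.minimal_rep_least[OF f.smult_minimal_rep_in_class[OF a]] by (simp add: eqs)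
  show "minimal_map (a \<odot>\<^bsub>L'\<^esub> x) = a \<odot>\<^bsub>M\<^esub> minimal_map x" if "minimal_reps_equivariant A M f"
    using that a by (simp add: eqs minimal_reps_equivariant_def)
qed

lemma minimal_map_morphism:
  "minimal_reps_equivariant A M f \<Longrightarrow> surp_morphism_on (ker_Mod L h) A L' M minimal_map"
  by (simp add: surp_morphism_on_def minimal_map_surp_additive minimal_map_smult(3))

lemma minimal_map_unique:
  assumes "d \<in> extensional (ker_Mod L h)"
    and "\<forall>x\<in>ker_Mod L h. \<forall>v u. choice x v u \<longrightarrow> d x = minimal_rep M f u"
  shows "d = minimal_map"
proof (rule extensionalityI[OF assms(1)])
  show "minimal_map \<in> extensional (ker_Mod L h)"
    by (simp add: minimal_map_def)
  show "d x = minimal_map x" if "x \<in> ker_Mod L h" for x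
    using that ex_choice[OF that] assms(2) minimal_map_choice by fastforce
qed

end

section \<open>The connecting maps of a diagram of systemic modules\<close>

theorem theoremC:
  fixes A :: "'a::semiring_1 system"
    and M' :: "('a, 'm'::comm_monoid_add) smodule"
    and N' :: "('a, 'n'::comm_monoid_add) smodule"
    and L' :: "('a, 'l'::comm_monoid_add) smodule"
    and M :: "('a, 'm::comm_monoid_add) smodule"
    and N :: "('a, 'n::comm_monoid_add) smodule"
    and L :: "('a, 'l::comm_monoid_add) smodule"
    and q :: "'m' \<Rightarrow> 'n'" and p :: "'n' \<Rightarrow> 'l'"
    and l :: "'m \<Rightarrow> 'n" and r :: "'n \<Rightarrow> 'l"
    and f :: "'m' \<Rightarrow> 'm" and g :: "'n' \<Rightarrow> 'n" and h :: "'l' \<Rightarrow> 'l"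
  assumes "semiring_system A"
    and "systemic_module A M'" "systemic_module A N'" "systemic_module A L'"
    and "systemic_module A M" "systemic_module A N" "systemic_module A L"
    and "surp_morphism A M' N' q" "surp_morphism A N' L' p"
    and "surp_morphism A M N l" "surp_morphism A N L r"
    and "surp_morphism A M' M f" "surp_morphism A N' N g" "surp_morphism A L' L h"
    and "g \<circ> q = l \<circ> f" "h \<circ> p = r \<circ> g"
    and "succ_onto L' p" "homomorphism A N' L' p"
    and "homomorphism A N' N g"
    and "prec_monic M N l" "homomorphism A M N l"
    and "prec_exact N' L' q p"
    and "succ_exact N L l r"
  shows
    \<comment> \<open>the kernel is stable under the operations that the maps below have to respect\<close>
    "(0 \<in> ker_Mod L h \<and>
      (\<forall>x\<in>ker_Mod L h. \<ominus>\<^bsub>L'\<^esub> x \<in> ker_Mod L h) \<and>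
      (\<forall>a\<in>tang A. \<forall>x\<in>ker_Mod L h. a \<odot>\<^bsub>L'\<^esub> x \<in> ker_Mod L h)) \<and>
     \<comment> \<open>both choices are possible\<close>
     (\<forall>x\<^sub>0\<in>ker_Mod L h. (\<exists>v\<^sub>0. x\<^sub>0 \<preceq>\<^bsub>L'\<^esub> p v\<^sub>0) \<and>
        (\<forall>v\<^sub>0. x\<^sub>0 \<preceq>\<^bsub>L'\<^esub> p v\<^sub>0 \<longrightarrow> (\<exists>u\<^sub>0. g v\<^sub>0 \<preceq>\<^bsub>N\<^esub> l u\<^sub>0))) \<and>
     \<comment> \<open>each choice lies in the class of any other one\<close>
     (\<forall>x\<^sub>0\<in>ker_Mod L h. \<forall>v\<^sub>0 u\<^sub>0 v\<^sub>1 u\<^sub>1.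
        connecting_choice L' N p g l x\<^sub>0 v\<^sub>0 u\<^sub>0 \<longrightarrow> connecting_choice L' N p g l x\<^sub>0 v\<^sub>1 u\<^sub>1 \<longrightarrow>
        u\<^sub>1 \<in> sys_class M f u\<^sub>0) \<and>
     \<comment> \<open>choices are compatible with the action\<close>
     (\<forall>a\<in>tang A. \<forall>x\<^sub>0\<in>ker_Mod L h. \<forall>v\<^sub>0 u\<^sub>0.
        connecting_choice L' N p g l x\<^sub>0 v\<^sub>0 u\<^sub>0 \<longrightarrow>
        connecting_choice L' N p g l (a \<odot>\<^bsub>L'\<^esub> x\<^sub>0) (a \<odot>\<^bsub>N'\<^esub> v\<^sub>0) (a \<odot>\<^bsub>M\<^esub> u\<^sub>0)) \<and>
     \<comment> \<open>the connecting map into the cokernel\<close>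
     (\<exists>d. d \<in> ker_Mod L h \<rightarrow>\<^sub>E coker_sys M f \<and>
        (\<forall>x\<^sub>0\<in>ker_Mod L h. \<exists>v\<^sub>0 u\<^sub>0.
           connecting_choice L' N p g l x\<^sub>0 v\<^sub>0 u\<^sub>0 \<and> d x\<^sub>0 = sys_class M f u\<^sub>0) \<and>
        (\<forall>x\<^sub>0\<in>ker_Mod L h. \<forall>v\<^sub>0 u\<^sub>0. connecting_choice L' N p g l x\<^sub>0 v\<^sub>0 u\<^sub>0 \<longrightarrow>
           u\<^sub>0 \<in> d x\<^sub>0 \<and> (\<forall>a\<in>tang A. a \<odot>\<^bsub>M\<^esub> u\<^sub>0 \<in> d (a \<odot>\<^bsub>L'\<^esub> x\<^sub>0))) \<and>
        (partition_on UNIV (coker_sys M f) \<longrightarrow>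
           (\<forall>x\<^sub>0\<in>ker_Mod L h. \<forall>v\<^sub>0 u\<^sub>0. connecting_choice L' N p g l x\<^sub>0 v\<^sub>0 u\<^sub>0 \<longrightarrow>
              d x\<^sub>0 = sys_class M f u\<^sub>0) \<and>
           (\<forall>a\<in>tang A. \<forall>x\<^sub>0\<in>ker_Mod L h. \<forall>b. d x\<^sub>0 = sys_class M f b \<longrightarrow>
              d (a \<odot>\<^bsub>L'\<^esub> x\<^sub>0) = sys_class M f (a \<odot>\<^bsub>M\<^esub> b)))) \<and>
     \<comment> \<open>the connecting map into the module\<close>
     (minimality M f \<longrightarrow>
        partition_on UNIV (coker_sys M f) \<and>
        ((\<forall>a\<in>tang A. \<exists>a'\<in>tang A. a' * a = 1) \<longrightarrow> minimal_reps_equivariant A M f) \<and>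
        (\<exists>!d. d \<in> extensional (ker_Mod L h) \<and>
           (\<forall>x\<^sub>0\<in>ker_Mod L h. \<forall>v\<^sub>0 u\<^sub>0. connecting_choice L' N p g l x\<^sub>0 v\<^sub>0 u\<^sub>0 \<longrightarrow>
              d x\<^sub>0 = minimal_rep M f u\<^sub>0) \<and>
           surp_additive_on (ker_Mod L h) L' M d \<and>
           (\<forall>a\<in>tang A. \<forall>x\<^sub>0\<in>ker_Mod L h.
              d (a \<odot>\<^bsub>L'\<^esub> x\<^sub>0) = minimal_rep M f (a \<odot>\<^bsub>M\<^esub> d x\<^sub>0) \<and>
              d (a \<odot>\<^bsub>L'\<^esub> x\<^sub>0) \<preceq>\<^bsub>M\<^esub> a \<odot>\<^bsub>M\<^esub> d x\<^sub>0) \<and>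
           (minimal_reps_equivariant A M f \<longrightarrow> surp_morphism_on (ker_Mod L h) A L' M d)))"
  (is "?stable \<and> ?possible \<and> ?unique \<and> ?action \<and> ?class_map \<and> (minimality M f \<longrightarrow> ?minimal_map)")
proof -
  interpret snake_diagram A M' N' L' M N L q p l r f g h
    using assms by (simp add: snake_diagram_def snake_diagram_axioms_def
        systemic_morphism_def systemic_morphism_axioms_def)
  have "?stable"
    using zero_in_ker neg_in_ker smult_in_ker by blast
  moreover have "?possible"
    using ex_lift ex_choice_of_lift by blast
  moreover have "?unique"
    using choice_in_class by blast
  moreover have "?action"
    using choice_smult by blast
  moreover have "?class_map"
  proof (intro exI[of _ class_map] conjI impI ballI allI)
    show "class_map \<in> ker_Mod L h \<rightarrow>\<^sub>E coker_sys M f"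
      by (rule class_map_in_coker)
  next
    fix a x v u
    assume "a \<in> tang A" and "x \<in> ker_Mod L h" and "connecting_choice L' N p g l x v u"
    then show "a \<odot>\<^bsub>M\<^esub> u \<in> class_map (a \<odot>\<^bsub>L'\<^esub> x)"
      by (blast intro: choice_in_class_map smult_in_ker choice_smult)
  qed (simp_all add: class_map_choice choice_in_class_map
      class_map_eq_if_partition class_map_equivariant_if_partition)
  moreover have "?minimal_map" if "minimality M f"
  proof -
    interpret minimal_snake_diagram A M' N' L' M N L q p l r f g h
      using that by unfold_locales
    show ?thesis
    proof (intro conjI impI)
      show "partition_on UNIV (coker_sys M f)"
        by (rule f.partition_coker_sys)
      show "minimal_reps_equivariant A M f" if "\<forall>a\<in>tang A. \<exists>a'\<in>tang A. a' * a = 1"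
        using that by (rule f.minimal_reps_equivariant_if_invertible)
    next
      show "\<exists>!d. d \<in> extensional (ker_Mod L h) \<and>
           (\<forall>x\<^sub>0\<in>ker_Mod L h. \<forall>v\<^sub>0 u\<^sub>0. connecting_choice L' N p g l x\<^sub>0 v\<^sub>0 u\<^sub>0 \<longrightarrow>
              d x\<^sub>0 = minimal_rep M f u\<^sub>0) \<and>
           surp_additive_on (ker_Mod L h) L' M d \<and>
           (\<forall>a\<in>tang A. \<forall>x\<^sub>0\<in>ker_Mod L h.
              d (a \<odot>\<^bsub>L'\<^esub> x\<^sub>0) = minimal_rep M f (a \<odot>\<^bsub>M\<^esub> d x\<^sub>0) \<and>
              d (a \<odot>\<^bsub>L'\<^esub> x\<^sub>0) \<preceq>\<^bsub>M\<^esub> a \<odot>\<^bsub>M\<^esub> d x\<^sub>0) \<and>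
           (minimal_reps_equivariant A M f \<longrightarrow> surp_morphism_on (ker_Mod L h) A L' M d)"
      proof (rule ex1I[of _ minimal_map], intro conjI ballI allI impI)
        show "minimal_map \<in> extensional (ker_Mod L h)"
          by (simp add: minimal_map_def)
      next
        fix x v u
        assume "x \<in> ker_Mod L h" and "connecting_choice L' N p g l x v u"
        then show "minimal_map x = minimal_rep M f u"
          by (rule minimal_map_choice)
      next
        fix a x
        assume "a \<in> tang A" and "x \<in> ker_Mod L h"
        then show "minimal_map (a \<odot>\<^bsub>L'\<^esub> x) = minimal_rep M f (a \<odot>\<^bsub>M\<^esub> minimal_map x)"
          and "minimal_map (a \<odot>\<^bsub>L'\<^esub> x) \<preceq>\<^bsub>M\<^esub> a \<odot>\<^bsub>M\<^esub> minimal_map x"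
          by (rule minimal_map_smult)+
      next
        fix d
        assume "d \<in> extensional (ker_Mod L h) \<and>
           (\<forall>x\<^sub>0\<in>ker_Mod L h. \<forall>v\<^sub>0 u\<^sub>0. connecting_choice L' N p g l x\<^sub>0 v\<^sub>0 u\<^sub>0 \<longrightarrow>
              d x\<^sub>0 = minimal_rep M f u\<^sub>0) \<and>
           surp_additive_on (ker_Mod L h) L' M d \<and>
           (\<forall>a\<in>tang A. \<forall>x\<^sub>0\<in>ker_Mod L h.
              d (a \<odot>\<^bsub>L'\<^esub> x\<^sub>0) = minimal_rep M f (a \<odot>\<^bsub>M\<^esub> d x\<^sub>0) \<and>
              d (a \<odot>\<^bsub>L'\<^esub> x\<^sub>0) \<preceq>\<^bsub>M\<^esub> a \<odot>\<^bsub>M\<^esub> d x\<^sub>0) \<and>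
           (minimal_reps_equivariant A M f \<longrightarrow> surp_morphism_on (ker_Mod L h) A L' M d)"
        then show "d = minimal_map"
          by (intro minimal_map_unique) blast+
      qed (rule minimal_map_surp_additive, rule minimal_map_morphism)
    qed
  qed
  ultimately show ?thesis
    by blast
qed

end
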